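(* Let $\mathfrak{g}=\mathfrak{g}_{3.6}\oplus\mathfrak{g}_1$ be the four-dimensional real Lie algebra with basis $\mathcal{B}=\{e_1,e_2,e_3,e_4\}$ whose nonzero Lie brackets (up to skew-symmetry) are $[e_2,e_3]=e_1$, $[e_3,e_1]=e_2$, $[e_1,e_2]=-e_3$. Let $\langle\cdot,\cdot\rangle$ be a pseudo-Riemannian inner product on $\mathfrak{g}$ and let $(R_{ij})$ be the matrix of its Ricci operator $\operatorname{Ric}$ in the basis $\mathcal{B}$. If $$R_{i4}=R_{4i}=0\ (i=1,2,3),\quad R_{21}=-R_{12},\quad R_{31}=R_{13},\quad R_{32}=R_{23},\quad R_{33}=R_{22}=R_{11},$$ then $\langle\cdot,\cdot\rangle$ is an algebraic Ricci soliton. Provided these identities are satisfied, $\operatorname{Ric}=\eta I_4+D$ where $\eta=R_{33}=R_{22}=R_{11}$ and $$D=\begin{bmatrix}0&R_{12}&R_{13}&0\\-R_{12}&0&R_{23}&0\\R_{13}&R_{23}&0&0\\0&0&0&R_{44}-R_{11}\end{bmatrix}$$ is (the matrix in the basis $\mathcal{B}$ of) a derivation of $\mathfrak{g}$.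
   Context: A pseudo-Riemannian inner product on a real Lie algebra $\mathfrak{g}$ is a nondegenerate symmetric bilinear form $\langle\cdot,\cdot\rangle$ on $\mathfrak{g}$ (of some signature $(r,s)$). Its Levi-Civita connection $\nabla$ is defined by $2\langle\nabla_uv,w\rangle=\langle[u,v],w\rangle+\langle[w,u],v\rangle+\langle[w,v],u\rangle$; its curvature is $R_{uv}=\nabla_{[u,v]}-[\nabla_u,\nabla_v]$; its Ricci curvature $\operatorname{ric}(u,v)$ is the trace of $w\mapsto R_{uw}v$; its Ricci operator $\operatorname{Ric}$ is the endomorphism of $\mathfrak{g}$ with $\langle\operatorname{Ric}(u),v\rangle=\operatorname{ric}(u,v)$. The matrix $(R_{ij})$ of $\operatorname{Ric}$ in a basis $\{e_i\}$ is given by $\operatorname{Ric}(e_j)=\sum_iR_{ij}e_i$ (the same column convention is used for $D$). A derivation is a linear map $D:\mathfrak{g}\to\mathfrak{g}$ with $D[x,y]=[D(x),y]+[x,D(y)]$ for all $x,y$. The inner product is an algebraic Ricci soliton if $\operatorname{Ric}=\eta\,\mathrm{Id}_{\mathfrak{g}}+D$ for some $\eta\in\mathbb{R}$ and some derivation $D$ of $\mathfrak{g}$. *)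

theory Defs
  imports "HOL-Analysis.Analysis"
begin

definition lie_bracket :: "('a::real_vector \<Rightarrow> 'a \<Rightarrow> 'a) \<Rightarrow> bool" where
  "lie_bracket br \<longleftrightarrow> bilinear br \<and> (\<forall>x. br x x = 0) \<and>
     (\<forall>x y z. br x (br y z) + br y (br z x) + br z (br x y) = 0)"

definition lie_derivation :: "('a::real_vector \<Rightarrow> 'a \<Rightarrow> 'a) \<Rightarrow> ('a \<Rightarrow> 'a) \<Rightarrow> bool" where
  "lie_derivation br D \<longleftrightarrow> linear D \<and> (\<forall>x y. D (br x y) = br (D x) y + br x (D y))"

definition pseudo_inner :: "('a::real_vector \<Rightarrow> 'a \<Rightarrow> real) \<Rightarrow> bool" where
  "pseudo_inner g \<longleftrightarrow> bilinear g \<and> (\<forall>x y. g x y = g y x) \<and>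
     (\<forall>x. (\<forall>y. g x y = 0) \<longrightarrow> x = 0)"

text \<open>In finite dimension a nondegenerate form represents every linear functional by a
  unique vector, so the definite descriptions below are meaningful.\<close>

lemma pseudo_inner_representation:
  fixes g :: "'a::euclidean_space \<Rightarrow> 'a \<Rightarrow> real"
  assumes g: "pseudo_inner g" and f: "linear f"
  shows "\<exists>!z. \<forall>w. g z w = f w"
proof -
  have bil: "bilinear g" and nondeg: "\<And>x. (\<And>y. g x y = 0) \<Longrightarrow> x = 0"
    using g unfolding pseudo_inner_def by auto
  have lin1: "linear (\<lambda>x. g x y)" and lin2: "linear (g x)" for x y
    using bil unfolding bilinear_def by auto
  define T where "T x = (\<Sum>b\<in>Basis. g x b *\<^sub>R b)" for x
  have expand: "h w = (\<Sum>b\<in>Basis. (w \<bullet> b) * h b)" if "linear h" for h :: "'a \<Rightarrow> real" and w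
  proof -
    have "h w = h (\<Sum>b\<in>Basis. (w \<bullet> b) *\<^sub>R b)"
      by (simp add: euclidean_representation)
    also have "\<dots> = (\<Sum>b\<in>Basis. (w \<bullet> b) * h b)"
      using that by (simp add: linear_sum linear_cmul)
    finally show ?thesis .
  qed
  have T_inner: "T x \<bullet> b = g x b" if "b \<in> Basis" for x b
    unfolding T_def using that by (simp add: inner_sum_left_Basis)
  have linT: "linear T"
    by (rule linearI)
      (simp_all add: T_def linear_add[OF lin1] linear_cmul[OF lin1] scaleR_left_distrib
        sum.distrib scaleR_right.sum)
  have "inj T"
    unfolding linear_injective_0[OF linT]
  proof (intro allI impI)
    fix x assume "T x = 0"
    then have "g x b = 0" if "b \<in> Basis" for b
      using T_inner[OF that, of x] by simp
    then have "g x y = 0" for y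
      by (subst expand[OF lin2]) simp
    then show "x = 0" by (rule nondeg)
  qed
  then have "surj T"
    using linT linear_injective_imp_surjective by blast
  then obtain z where z: "T z = (\<Sum>b\<in>Basis. f b *\<^sub>R b)"
    by (metis surjD)
  have "g z b = f b" if "b \<in> Basis" for b
    using T_inner[OF that, of z] that unfolding z by (simp add: inner_sum_left_Basis)
  then have zf: "g z w = f w" for w
    by (subst expand[OF lin2], subst expand[OF f]) simp
  show ?thesis
  proof (rule ex1I[of _ z])
    show "\<forall>w. g z w = f w" using zf by simp
    fix z' assume "\<forall>w. g z' w = f w"
    then have "g (z' - z) w = 0" for w
      using linear_diff[OF lin1, of z' z w] zf by simp
    then show "z' = z" using nondeg[of "z' - z"] by simp
  qed
qed

definition levi_civita ::
  "('a::real_vector \<Rightarrow> 'a \<Rightarrow> 'a) \<Rightarrow> ('a \<Rightarrow> 'a \<Rightarrow> real) \<Rightarrow> 'a \<Rightarrow> 'a \<Rightarrow> 'a" where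
  "levi_civita br g u v =
     (THE z. \<forall>w. 2 * g z w = g (br u v) w + g (br w u) v + g (br w v) u)"

definition curvature ::
  "('a::real_vector \<Rightarrow> 'a \<Rightarrow> 'a) \<Rightarrow> ('a \<Rightarrow> 'a \<Rightarrow> real) \<Rightarrow> 'a \<Rightarrow> 'a \<Rightarrow> 'a \<Rightarrow> 'a" where
  "curvature br g u v w = levi_civita br g (br u v) w -
     (levi_civita br g u (levi_civita br g v w) - levi_civita br g v (levi_civita br g u w))"

definition ricci ::
  "(real^'n \<Rightarrow> real^'n \<Rightarrow> real^'n) \<Rightarrow> (real^'n \<Rightarrow> real^'n \<Rightarrow> real) \<Rightarrow> real^'n \<Rightarrow> real^'n \<Rightarrow> real" where
  "ricci br g u v = trace (matrix (\<lambda>w. curvature br g u w v))"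

definition ricci_operator ::
  "(real^'n \<Rightarrow> real^'n \<Rightarrow> real^'n) \<Rightarrow> (real^'n \<Rightarrow> real^'n \<Rightarrow> real) \<Rightarrow> real^'n \<Rightarrow> real^'n" where
  "ricci_operator br g u = (THE z. \<forall>v. g z v = ricci br g u v)"

definition algebraic_ricci_soliton ::
  "(real^'n \<Rightarrow> real^'n \<Rightarrow> real^'n) \<Rightarrow> (real^'n \<Rightarrow> real^'n \<Rightarrow> real) \<Rightarrow> bool" where
  "algebraic_ricci_soliton br g \<longleftrightarrow>
     (\<exists>\<eta> D. lie_derivation br D \<and> (\<forall>x. ricci_operator br g x = \<eta> *\<^sub>R x + D x))"

text \<open>The Lie algebra is realised on \<^typ>\<open>real^4\<close>, with \<open>e\<^sub>i = axis i 1\<close>.\<close>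

definition g36_g1 :: "real^4 \<Rightarrow> real^4 \<Rightarrow> real^4" where
  "g36_g1 x y = (x$2 * y$3 - x$3 * y$2) *\<^sub>R axis 1 1 + (x$3 * y$1 - x$1 * y$3) *\<^sub>R axis 2 1
     - (x$1 * y$2 - x$2 * y$1) *\<^sub>R axis 3 1"

lemma vector_4:
  "(vector [a, b, c, d] :: ('a::zero)^4) $ 1 = a"
  "(vector [a, b, c, d] :: ('a::zero)^4) $ 2 = b"
  "(vector [a, b, c, d] :: ('a::zero)^4) $ 3 = c"
  "(vector [a, b, c, d] :: ('a::zero)^4) $ 4 = d"
  unfolding vector_def by simp_all

lemma g36_g1_basis_brackets:
  "g36_g1 (axis 2 1) (axis 3 1) = axis 1 1"
  "g36_g1 (axis 3 1) (axis 1 1) = axis 2 1"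
  "g36_g1 (axis 1 1) (axis 2 1) = - axis 3 1"
  "g36_g1 x (axis 4 1) = 0"
  by (simp_all add: g36_g1_def vec_eq_iff forall_4 axis_def)

lemma lie_bracket_g36_g1: "lie_bracket g36_g1"
  unfolding lie_bracket_def bilinear_def
  by (auto intro!: linearI simp: g36_g1_def vec_eq_iff forall_4 axis_def algebra_simps)

end

theory Submission
  imports Defs
begin

text \<open>The identities imposed on \<open>R\<close> say exactly that \<open>R\<close> minus
  \<open>R$1$1\<close> times the identity is \<open>D\<close>, so what remains is that every matrix
  of that shape is a derivation (\<open>lie_derivation_g36_g1\<close>): it is an inner derivation
  plus a multiple of the projection onto the central line of e4. To pass from the matrix to the
  operator, the Ricci operator must be linear. Both it and the connection are definite descriptions,
  so nondegeneracy first yields their defining equations; linearity then passes from the Koszul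
  formula to the connection, the curvature, the trace and finally the operator
  (\<open>linear_ricci_operator\<close>).\<close>

lemma levi_civita_koszul:
  fixes g :: "'a::euclidean_space \<Rightarrow> 'a \<Rightarrow> real"
  assumes br: "bilinear br" and g: "pseudo_inner g"
  shows "2 * g (levi_civita br g u v) w = g (br u v) w + g (br w u) v + g (br w v) u"
proof -
  have bg: "bilinear g" using g by (simp add: pseudo_inner_def)
  \<comment> \<open>Half of the Koszul expression is the functional that the connection
    represents.\<close>
  have "linear (\<lambda>w. (g (br u v) w + g (br w u) v + g (br w v) u) / 2)"
    by (rule linearI)
      (simp_all add: bilinear_ladd[OF bg] bilinear_radd[OF bg] bilinear_lmul[OF bg]
        bilinear_rmul[OF bg] bilinear_ladd[OF br] bilinear_lmul[OF br] field_simps)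
  from pseudo_inner_representation[OF g this]
  have "\<exists>!z. \<forall>w. 2 * g z w = g (br u v) w + g (br w u) v + g (br w v) u"
    by (simp add: field_simps)
  from theI'[OF this] show ?thesis
    unfolding levi_civita_def by blast
qed

lemma pseudo_inner_eqI:
  assumes g: "pseudo_inner g" and eq: "\<And>w. g x w = g y w"
  shows "x = y"
proof -
  have bg: "bilinear g" using g by (simp add: pseudo_inner_def)
  have "g (x - y) w = 0" for w
    by (simp add: bilinear_lsub[OF bg] eq)
  then show ?thesis
    using g unfolding pseudo_inner_def by (metis eq_iff_diff_eq_0)
qed

text \<open>The right side of the Koszul formula is trilinear, and a vector is determined by its
  pairings under \<open>g\<close>.\<close>

lemma bilinear_levi_civita:
  fixes g :: "'a::euclidean_space \<Rightarrow> 'a \<Rightarrow> real"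
  assumes br: "bilinear br" and g: "pseudo_inner g"
  shows "bilinear (levi_civita br g)"
proof -
  have bg: "bilinear g" using g by (simp add: pseudo_inner_def)
  note K = levi_civita_koszul[OF br g]
  note simps = bilinear_ladd[OF bg] bilinear_radd[OF bg] bilinear_lmul[OF bg]
    bilinear_rmul[OF bg] bilinear_ladd[OF br] bilinear_radd[OF br] bilinear_lmul[OF br]
    bilinear_rmul[OF br]
  have eqI: "x = y" if "\<And>w. 2 * g x w = 2 * g y w" for x y
    using that by (intro pseudo_inner_eqI[OF g]) simp
  show ?thesis
    unfolding bilinear_def
  proof (intro conjI allI linearI)
    fix u v v' :: 'a and c :: real
    show "levi_civita br g u (v + v') = levi_civita br g u v + levi_civita br g u v'"
      by (rule eqI) (simp only: K simps distrib_left add_ac)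
    show "levi_civita br g (v + v') u = levi_civita br g v u + levi_civita br g v' u"
      by (rule eqI) (simp only: K simps distrib_left add_ac)
    show "levi_civita br g u (c *\<^sub>R v) = c *\<^sub>R levi_civita br g u v"
      by (rule eqI) (simp only: K simps mult.left_commute[of 2] real_scaleR_def distrib_left)
    show "levi_civita br g (c *\<^sub>R v) u = c *\<^sub>R levi_civita br g v u"
      by (rule eqI) (simp only: K simps mult.left_commute[of 2] real_scaleR_def distrib_left)
  qed
qed

text \<open>Curvature is assembled from bilinear maps, and the trace is linear. Linearity on the
  right makes the Ricci operator exist; linearity on the left makes it linear.\<close>

lemma
  fixes g :: "real^'n \<Rightarrow> real^'n \<Rightarrow> real"
  assumes br: "bilinear br" and g: "pseudo_inner g"
  shows linear_ricci_left: "linear (\<lambda>u. ricci br g u v)"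
    and linear_ricci_right: "linear (ricci br g u)"
proof -
  note L = bilinear_levi_civita[OF br g]
  note simps = bilinear_ladd[OF L] bilinear_radd[OF L] bilinear_lmul[OF L]
    bilinear_rmul[OF L] bilinear_ladd[OF br] bilinear_lmul[OF br]
  have "curvature br g (u + u') w v = curvature br g u w v + curvature br g u' w v"
    "curvature br g (c *\<^sub>R u) w v = c *\<^sub>R curvature br g u w v"
    "curvature br g u w (v + v') = curvature br g u w v + curvature br g u w v'"
    "curvature br g u w (c *\<^sub>R v) = c *\<^sub>R curvature br g u w v"
    for u u' w v v' c
    by (simp_all add: curvature_def simps algebra_simps)
  then show "linear (\<lambda>u. ricci br g u v)" "linear (ricci br g u)"
    by (auto intro!: linearI
        simp: ricci_def trace_def matrix_def sum.distrib sum_distrib_left)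
qed

lemma ricci_operator_ricci:
  fixes g :: "real^'n \<Rightarrow> real^'n \<Rightarrow> real"
  assumes br: "bilinear br" and g: "pseudo_inner g"
  shows "g (ricci_operator br g u) v = ricci br g u v"
  using theI'[OF pseudo_inner_representation[OF g linear_ricci_right[OF br g, of u]]]
  unfolding ricci_operator_def by blast

lemma linear_ricci_operator:
  fixes g :: "real^'n \<Rightarrow> real^'n \<Rightarrow> real"
  assumes br: "bilinear br" and g: "pseudo_inner g"
  shows "linear (ricci_operator br g)"
proof -
  have bg: "bilinear g" using g by (simp add: pseudo_inner_def)
  note lin = linear_ricci_left[OF br g]
  show ?thesis
    by (intro linearI pseudo_inner_eqI[OF g])
      (simp_all add: ricci_operator_ricci[OF br g] bilinear_ladd[OF bg] bilinear_lmul[OF bg]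
        linear_add[OF lin] linear_cmul[OF lin])
qed

text \<open>The 3x3 block is the adjoint action of - c e1 + b e2 - a e3. The entry \<open>d\<close>
  scales the projection onto e4, a derivation because it kills all brackets and has central image.
  The proof checks the Leibniz rule in coordinates.\<close>

lemma lie_derivation_g36_g1:
  fixes a b c d :: real
  defines "D \<equiv> vector [vector [0, a, b, 0], vector [- a, 0, c, 0], vector [b, c, 0, 0],
    vector [0, 0, 0, d]] :: real^4^4"
  shows "lie_derivation g36_g1 (\<lambda>x. D *v x)"
  unfolding lie_derivation_def
  by (simp add: D_def g36_g1_def vec_eq_iff forall_4 axis_def matrix_vector_mult_def sum_4
      vector_4 algebra_simps)

theorem theorem3p10:
  fixes g :: "real^4 \<Rightarrow> real^4 \<Rightarrow> real" and R D :: "real^4^4"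
  assumes g: "pseudo_inner g"
    and R: "R = matrix (ricci_operator g36_g1 g)"
    and "\<And>i. i \<in> {1, 2, 3} \<Longrightarrow> R$i$4 = 0 \<and> R$4$i = 0"
    and "R$2$1 = - R$1$2" and "R$3$1 = R$1$3" and "R$3$2 = R$2$3"
    and "R$3$3 = R$2$2" and "R$2$2 = R$1$1"
    and D: "D = vector
      [vector [0, R$1$2, R$1$3, 0],
       vector [- R$1$2, 0, R$2$3, 0],
       vector [R$1$3, R$2$3, 0, 0],
       vector [0, 0, 0, R$4$4 - R$1$1]]"
  shows "algebraic_ricci_soliton g36_g1 g \<and>
    R = R$1$1 *\<^sub>R mat 1 + D \<and>
    (\<forall>x. ricci_operator g36_g1 g x = R$1$1 *\<^sub>R x + D *v x) \<and>
    lie_derivation g36_g1 (\<lambda>x. D *v x)"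
proof -
  have "bilinear g36_g1"
    using lie_bracket_g36_g1 by (simp add: lie_bracket_def)
  then have lin: "linear (ricci_operator g36_g1 g)"
    using g by (rule linear_ricci_operator)
  have mat: "R = R$1$1 *\<^sub>R mat 1 + D"
    using assms(3)[of 1] assms(3)[of 2] assms(3)[of 3] assms(4-8)
    by (simp add: D vec_eq_iff forall_4 vector_4 mat_def)
  have ric: "ricci_operator g36_g1 g x = R$1$1 *\<^sub>R x + D *v x" for x
  proof -
    have "ricci_operator g36_g1 g x = R *v x"
      unfolding R by (simp add: matrix_works lin)
    also have "\<dots> = R$1$1 *\<^sub>R x + D *v x"
      \<comment> \<open>\<open>R\<close> occurs on both sides of \<open>mat\<close>, so a single
        substitution is made instead of repeated rewriting.\<close>
      by (subst mat) (simp add: matrix_vector_mult_add_rdistrib scaleR_matrix_vector_assoc[symmetric])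
    finally show ?thesis .
  qed
  have "lie_derivation g36_g1 (\<lambda>x. D *v x)"
    unfolding D by (rule lie_derivation_g36_g1)
  with mat ric show ?thesis
    unfolding algebraic_ricci_soliton_def by blast
qed

end
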